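(* Let $\mathcal{Y}$ be an $m\times n$ zero-nonzero pattern and let $G$ be the cobipartite graph associated with $\mathcal{Y}$. If $G$ is saturated with respect to the corresponding clique partition, then $Z(G) = m+n-\operatorname{tri}(\mathcal{Y})$.
   Context: A zero-nonzero pattern is a matrix with entries in $\{0,*\}$; a square pattern is a triangle if some permutation of its rows followed by some independent permutation of its columns yields a lower-triangular pattern with only $*$ entries on the diagonal; $\operatorname{tri}(\mathcal{Y})$ is the largest size of a square submatrix of $\mathcal{Y}$ that is a triangle. The cobipartite graph associated with $\mathcal{Y}$ is the simple graph on vertex set $V_r\cup V_c$ with $V_r=\{r_1,\dots,r_m\}$, $V_c=\{c_1,\dots,c_n\}$ disjoint, in which $V_r$ and $V_c$ are each cliques and $r_i$ is adjacent to $c_j$ exactly when the $(i,j)$ entry of $\mathcal{Y}$ is $*$; $(V_r,V_c)$ is the corresponding clique partition. $G$ is saturated with respect to $(V_r,V_c)$ if every vertex of $V_r$ has a neighbor in $V_c$ and every vertex of $V_c$ has a neighbor in $V_r$. $Z(G)$ is the zero forcing number: the smallest size of a set $F$ of initially filled vertices such that repeatedly applying the rule "a filled vertex whose only unfilled neighbor is $u$ forces $u$ to become filled" eventually fills all vertices. *)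

theory Defs
  imports
    "HOL-Combinatorics.Permutations"
    "Jordan_Normal_Form.DL_Submatrix"
    "Graph_Theory.Pair_Digraph"
begin

datatype zn_entry = Zero | Star

type_synonym zn_pattern = "zn_entry mat"

definition zn_triangle :: "zn_pattern \<Rightarrow> bool" where
  "zn_triangle T \<longleftrightarrow> square_mat T \<and>
     (\<exists>p q. p permutes {..<dim_row T} \<and> q permutes {..<dim_row T} \<and>
        (\<forall>i < dim_row T. T $$ (p i, q i) = Star) \<and>
        (\<forall>i < dim_row T. \<forall>j < dim_row T. i < j \<longrightarrow> T $$ (p i, q j) = Zero))"

text \<open>The empty submatrix is a triangle, so \<^term>\<open>tri Y = 0\<close> for an all-zero pattern.\<close>

definition tri :: "zn_pattern \<Rightarrow> nat" where
  "tri Y = Max {k. \<exists>I J. I \<subseteq> {..<dim_row Y} \<and> J \<subseteq> {..<dim_col Y} \<and>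
                        card I = k \<and> card J = k \<and> zn_triangle (submatrix Y I J)}"

definition nbhd :: "'a pair_pre_digraph \<Rightarrow> 'a \<Rightarrow> 'a set" where
  "nbhd G u = {v. (u, v) \<in> parcs G}"

definition clique :: "'a pair_pre_digraph \<Rightarrow> 'a set \<Rightarrow> bool" where
  "clique G A \<longleftrightarrow> A \<subseteq> pverts G \<and> (\<forall>u\<in>A. \<forall>v\<in>A. u \<noteq> v \<longrightarrow> (u, v) \<in> parcs G)"

definition clique_partition :: "'a pair_pre_digraph \<Rightarrow> 'a set \<Rightarrow> 'a set \<Rightarrow> bool" where
  "clique_partition G A B \<longleftrightarrow>
     A \<union> B = pverts G \<and> A \<inter> B = {} \<and> clique G A \<and> clique G B"

definition saturated :: "'a pair_pre_digraph \<Rightarrow> 'a set \<Rightarrow> 'a set \<Rightarrow> bool" where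
  "saturated G A B \<longleftrightarrow> (\<forall>u\<in>A. nbhd G u \<inter> B \<noteq> {}) \<and> (\<forall>v\<in>B. nbhd G v \<inter> A \<noteq> {})"

inductive force_step :: "'a pair_pre_digraph \<Rightarrow> 'a set \<Rightarrow> 'a set \<Rightarrow> bool" for G where
  force: "u \<in> F \<Longrightarrow> nbhd G u - F = {w} \<Longrightarrow> force_step G F (insert w F)"

definition zero_forcing_set :: "'a pair_pre_digraph \<Rightarrow> 'a set \<Rightarrow> bool" where
  "zero_forcing_set G F \<longleftrightarrow> F \<subseteq> pverts G \<and> (force_step G)\<^sup>*\<^sup>* F (pverts G)"

definition zero_forcing_number :: "'a pair_pre_digraph \<Rightarrow> nat" where
  "zero_forcing_number G = (LEAST k. \<exists>F. zero_forcing_set G F \<and> card F = k)"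

text \<open>Row vertices are \<^term>\<open>Inl i\<close>, column vertices are \<^term>\<open>Inr j\<close>.\<close>

definition row_verts :: "zn_pattern \<Rightarrow> (nat + nat) set" where
  "row_verts Y = Inl ` {..<dim_row Y}"

definition col_verts :: "zn_pattern \<Rightarrow> (nat + nat) set" where
  "col_verts Y = Inr ` {..<dim_col Y}"

text \<open>As usual in this graph library, an undirected edge is a pair of opposite arcs.\<close>

definition cobipartite_graph :: "zn_pattern \<Rightarrow> (nat + nat) pair_pre_digraph" where
  "cobipartite_graph Y =
     \<lparr> pverts = row_verts Y \<union> col_verts Y,
       parcs = {(u, v). u \<in> row_verts Y \<and> v \<in> row_verts Y \<and> u \<noteq> v}
             \<union> {(u, v). u \<in> col_verts Y \<and> v \<in> col_verts Y \<and> u \<noteq> v}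
             \<union> {(Inl i, Inr j) | i j. i < dim_row Y \<and> j < dim_col Y \<and> Y $$ (i, j) = Star}
             \<union> {(Inr j, Inl i) | i j. i < dim_row Y \<and> j < dim_col Y \<and> Y $$ (i, j) = Star} \<rparr>"

lemma pair_graph_cobipartite_graph: "pair_graph (cobipartite_graph Y)"
proof -
  let ?G = "cobipartite_graph Y"
  have fin: "finite (pverts ?G)"
    by (simp add: cobipartite_graph_def row_verts_def col_verts_def)
  have sub: "parcs ?G \<subseteq> pverts ?G \<times> pverts ?G"
    by (auto simp: cobipartite_graph_def row_verts_def col_verts_def)
  have "finite (parcs ?G)"
    using finite_subset[OF sub] fin by blast
  moreover have "symmetric (with_proj ?G)"
    unfolding symmetric_def with_proj_simps by (auto simp: cobipartite_graph_def intro!: symI)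
  moreover have "fst e \<noteq> snd e" if "e \<in> parcs ?G" for e
    using that by (auto simp: cobipartite_graph_def)
  ultimately show ?thesis
    using fin sub by unfold_locales auto
qed

lemma clique_partition_cobipartite_graph:
  "clique_partition (cobipartite_graph Y) (row_verts Y) (col_verts Y)"
  by (auto simp: clique_partition_def clique_def cobipartite_graph_def row_verts_def col_verts_def)

end

theory Submission
  imports Defs
begin

text \<open>
  A chain of forces whose sources are all rows and whose targets are all columns is, read in
  chronological order, exactly a triangle of the pattern: each source is adjacent to its own target
  and to none of the later ones. Leaving the columns of a largest triangle unfilled therefore gives
  a zero forcing set. Conversely, the first force already shows that one of the two cliques, say
  the rows, is filled afterwards. From then on only columns get forced, and a column can act as a
  source only when a single vertex remains; by saturation it may be replaced by a row. If the first
  force is from a row to a row, its target may be replaced by any column neighbour of the source,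
  again by saturation.
\<close>

text \<open>A triangle with its row and column permutations absorbed into two listings
  \<open>r\<close> and \<open>c\<close>. The relation \<open>P\<close> is left abstract so that one
  notion covers both star entries of a pattern and adjacency in a graph.\<close>

definition staircase :: "('a \<Rightarrow> 'b \<Rightarrow> bool) \<Rightarrow> nat \<Rightarrow> (nat \<Rightarrow> 'a) \<Rightarrow> (nat \<Rightarrow> 'b) \<Rightarrow> bool" where
  "staircase P k r c \<longleftrightarrow>
     (\<forall>i<k. P (r i) (c i)) \<and> (\<forall>i j. i < j \<longrightarrow> j < k \<longrightarrow> \<not> P (r i) (c j))"

text \<open>For \<open>i < j\<close> the diagonal relations hold while \<open>P (r i) (c j)\<close>
  fails, so a repeated row or column would be contradictory.\<close>

lemma staircase_inj_on:
  assumes "staircase P k r c"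
  shows "inj_on r {..<k}" "inj_on c {..<k}"
proof -
  have "r i \<noteq> r j" "c i \<noteq> c j" if "i < j" "j < k" for i j
  proof -
    have "P (r i) (c i)" "P (r j) (c j)" "\<not> P (r i) (c j)"
      using assms that by (auto simp: staircase_def)
    then show "r i \<noteq> r j" "c i \<noteq> c j" by auto
  qed
  then show "inj_on r {..<k}" "inj_on c {..<k}"
    by (auto intro: linorder_inj_onI')
qed

text \<open>Transposing moves the forbidden relations to the other side of the diagonal; reversing
  the order moves them back. This exchanges the roles of the two cliques.\<close>

lemma staircase_rev:
  assumes "staircase P k r c"
  shows "staircase (\<lambda>x y. P y x) k (\<lambda>i. c (k - Suc i)) (\<lambda>i. r (k - Suc i))"
  using assms by (auto simp: staircase_def)

lemma staircase_Cons:
  assumes "staircase P k r c" "P a b" "\<And>j. j < k \<Longrightarrow> \<not> P a (c j)"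
  shows "staircase P (Suc k) (case_nat a r) (case_nat b c)"
  using assms by (auto simp: staircase_def split: nat.splits)

subsection \<open>Triangles of a pattern\<close>

lemma zn_triangle_imp_staircase:
  assumes "I \<subseteq> {..<dim_row Y}" "J \<subseteq> {..<dim_col Y}" "card I = k" "card J = k"
    and "zn_triangle (submatrix Y I J)"
  shows "\<exists>r c. staircase (\<lambda>i j. Y $$ (i, j) = Star) k r c \<and>
           r ` {..<k} \<subseteq> {..<dim_row Y} \<and> c ` {..<k} \<subseteq> {..<dim_col Y}"
proof -
  \<comment> \<open>Dimensions and entries of a \<open>submatrix\<close> are stated through index
    sets cut down to the matrix range; here the cut changes nothing.\<close>
  have eq: "{i. i < dim_row Y \<and> i \<in> I} = I" "{j. j < dim_col Y \<and> j \<in> J} = J"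
    using assms(1,2) by auto
  have entry: "submatrix Y I J $$ (i, j) = Y $$ (pick I i, pick J j)" if "i < k" "j < k" for i j
    using submatrix_index[of i Y I j J] that assms(3,4) eq by simp
  have dim: "dim_row (submatrix Y I J) = k"
    using assms(3) eq by (simp add: dim_submatrix)
  obtain p q where pq: "p permutes {..<k}" "q permutes {..<k}"
    "\<forall>i<k. submatrix Y I J $$ (p i, q i) = Star"
    "\<forall>i<k. \<forall>j<k. i < j \<longrightarrow> submatrix Y I J $$ (p i, q j) = Zero"
    using assms(5) unfolding zn_triangle_def dim by blast
  have lt: "p i < k" "q i < k" if "i < k" for i
    using permutes_in_image[OF pq(1), of i] permutes_in_image[OF pq(2), of i] that by auto
  have "staircase (\<lambda>i j. Y $$ (i, j) = Star) k (\<lambda>i. pick I (p i)) (\<lambda>i. pick J (q i))"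
    using pq(3,4) lt by (simp add: staircase_def entry)
  moreover have "pick I (p i) \<in> I" "pick J (q i) \<in> J" if "i < k" for i
    using lt[OF that] assms(3,4) by (auto intro: pick_in_set_le)
  ultimately show ?thesis
    using assms(1,2) by (intro exI[of _ "\<lambda>i. pick I (p i)"] exI[of _ "\<lambda>i. pick J (q i)"]) auto
qed

text \<open>A submatrix lists its indices in increasing order through \<open>pick\<close>. Any other
  listing without repetition differs from that one by the permutation sending each position to the
  rank of its value.\<close>

lemma inj_on_factor_pick:
  fixes r :: "nat \<Rightarrow> nat"
  assumes "inj_on r {..<k}"
  obtains p where "p permutes {..<k}" "\<And>i. i < k \<Longrightarrow> pick (r ` {..<k}) (p i) = r i"
proof -
  let ?I = "r ` {..<k}"
  define f where "f i = card {a \<in> ?I. a < r i}" for i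
  \<comment> \<open>\<open>permutes\<close> demands the identity outside
    \<open>{..<k}\<close>.\<close>
  define p where "p i = (if i < k then f i else i)" for i
  have pick: "pick ?I (f i) = r i" if "i < k" for i
    unfolding f_def using that by (intro pick_card_in_set) auto
  have "inj_on f {..<k}"
  proof (rule inj_onI)
    fix i j assume ij: "i \<in> {..<k}" "j \<in> {..<k}" "f i = f j"
    with pick[of i] pick[of j] have "r i = r j" by simp
    with ij assms show "i = j" by (auto dest: inj_onD)
  qed
  moreover have "f ` {..<k} \<subseteq> {..<k}"
  proof (clarsimp)
    fix i assume "i < k"
    then have "{a \<in> ?I. a < r i} \<subset> ?I" by auto
    then have "f i < card ?I" unfolding f_def by (intro psubset_card_mono) auto
    also have "card ?I = k" using card_image[OF assms] by simp
    finally show "f i < k" .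
  qed
  ultimately have "bij_betw f {..<k} {..<k}"
    by (simp add: bij_betw_def endo_inj_surj)
  then have "bij_betw p {..<k} {..<k}"
    by (rule bij_betw_cong[THEN iffD1, rotated]) (simp add: p_def)
  then have "p permutes {..<k}"
    by (rule bij_imp_permutes) (simp add: p_def)
  then show thesis using that[of p] pick by (simp add: p_def)
qed

lemma staircase_imp_zn_triangle:
  assumes s: "staircase (\<lambda>i j. Y $$ (i, j) = Star) k r c"
    and r: "r ` {..<k} \<subseteq> {..<dim_row Y}" and c: "c ` {..<k} \<subseteq> {..<dim_col Y}"
  shows "zn_triangle (submatrix Y (r ` {..<k}) (c ` {..<k}))"
proof -
  let ?I = "r ` {..<k}" and ?J = "c ` {..<k}"
  have eq: "{i. i < dim_row Y \<and> i \<in> ?I} = ?I" "{j. j < dim_col Y \<and> j \<in> ?J} = ?J"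
    using r c by auto
  have card: "card ?I = k" "card ?J = k"
    using staircase_inj_on[OF s] by (simp_all add: card_image)
  have entry: "submatrix Y ?I ?J $$ (i, j) = Y $$ (pick ?I i, pick ?J j)" if "i < k" "j < k" for i j
    using submatrix_index[of i Y ?I j ?J] that unfolding eq card by simp
  have dim: "dim_row (submatrix Y ?I ?J) = k" "dim_col (submatrix Y ?I ?J) = k"
    unfolding dim_submatrix eq card by simp_all
  obtain p where p: "p permutes {..<k}" "\<And>i. i < k \<Longrightarrow> pick ?I (p i) = r i"
    using inj_on_factor_pick[OF staircase_inj_on(1)[OF s]] by blast
  obtain q where q: "q permutes {..<k}" "\<And>i. i < k \<Longrightarrow> pick ?J (q i) = c i"
    using inj_on_factor_pick[OF staircase_inj_on(2)[OF s]] by blast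
  have lt: "p i < k" "q i < k" if "i < k" for i
    using permutes_in_image[OF p(1), of i] permutes_in_image[OF q(1), of i] that by auto
  have "Y $$ (r i, c j) = Zero" if "i < j" "j < k" for i j
    using s that by (cases "Y $$ (r i, c j)") (auto simp: staircase_def)
  moreover have "Y $$ (r i, c i) = Star" if "i < k" for i
    using s that by (simp add: staircase_def)
  ultimately show ?thesis
    unfolding zn_triangle_def square_mat.simps dim using p q lt
    by (intro conjI exI[of _ p] exI[of _ q]) (auto simp: entry)
qed

lemma tri_eq_Max_staircase:
  "tri Y = Max {k. \<exists>r c. staircase (\<lambda>i j. Y $$ (i, j) = Star) k r c \<and>
              r ` {..<k} \<subseteq> {..<dim_row Y} \<and> c ` {..<k} \<subseteq> {..<dim_col Y}}" (is "_ = Max ?S")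
proof -
  have "(\<exists>I J. I \<subseteq> {..<dim_row Y} \<and> J \<subseteq> {..<dim_col Y} \<and> card I = k \<and> card J = k \<and>
          zn_triangle (submatrix Y I J)) \<longleftrightarrow> k \<in> ?S" for k
  proof
    assume "k \<in> ?S"
    then obtain r c where "staircase (\<lambda>i j. Y $$ (i, j) = Star) k r c"
      "r ` {..<k} \<subseteq> {..<dim_row Y}" "c ` {..<k} \<subseteq> {..<dim_col Y}" by blast
    then show "\<exists>I J. I \<subseteq> {..<dim_row Y} \<and> J \<subseteq> {..<dim_col Y} \<and> card I = k \<and> card J = k \<and>
        zn_triangle (submatrix Y I J)"
      using staircase_imp_zn_triangle[of Y k r c] staircase_inj_on[of _ k r c]
      by (intro exI[of _ "r ` {..<k}"] exI[of _ "c ` {..<k}"]) (auto simp: card_image)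
  qed (use zn_triangle_imp_staircase in blast)
  then show ?thesis unfolding tri_def by simp
qed

lemma finite_staircase_sizes:
  fixes P :: "nat \<Rightarrow> 'b \<Rightarrow> bool"
  shows "finite {k. \<exists>r c. staircase P k r c \<and> r ` {..<k} \<subseteq> {..<m::nat} \<and> c ` {..<k} \<subseteq> C}"
proof (rule finite_subset)
  have "k \<le> m" if "staircase P k r c" "r ` {..<k} \<subseteq> {..<m}" for k r and c :: "nat \<Rightarrow> 'b"
    using card_inj_on_le[OF staircase_inj_on(1)[OF that(1)] that(2)] by simp
  then show "{k. \<exists>r c. staircase P k r c \<and> r ` {..<k} \<subseteq> {..<m} \<and> c ` {..<k} \<subseteq> C} \<subseteq> {..m}"
    by blast
qed simp

lemma staircase_le_tri:
  assumes "staircase (\<lambda>i j. Y $$ (i, j) = Star) k r c"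
    "r ` {..<k} \<subseteq> {..<dim_row Y}" "c ` {..<k} \<subseteq> {..<dim_col Y}"
  shows "k \<le> tri Y"
  unfolding tri_eq_Max_staircase using assms by (intro Max_ge finite_staircase_sizes) auto

lemma ex_staircase_tri:
  obtains r c where "staircase (\<lambda>i j. Y $$ (i, j) = Star) (tri Y) r c"
    "r ` {..<tri Y} \<subseteq> {..<dim_row Y}" "c ` {..<tri Y} \<subseteq> {..<dim_col Y}"
proof -
  let ?S = "{k. \<exists>r c. staircase (\<lambda>i j. Y $$ (i, j) = Star) k r c \<and>
              r ` {..<k} \<subseteq> {..<dim_row Y} \<and> c ` {..<k} \<subseteq> {..<dim_col Y}}"
  \<comment> \<open>The empty staircase makes the set nonempty, so its maximum is attained.\<close>
  have "0 \<in> ?S" by (simp add: staircase_def)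
  then have "tri Y \<in> ?S"
    unfolding tri_eq_Max_staircase by (intro Max_in finite_staircase_sizes) blast
  then show thesis using that by blast
qed

subsection \<open>Zero forcing in cobipartite graphs\<close>

text \<open>The assumptions are symmetric in \<open>A\<close> and \<open>B\<close>, so each result
  proved for forces out of \<open>A\<close> transfers to \<open>B\<close> by
  \<open>swap\<close>.\<close>

locale saturated_cobipartite =
  fixes G :: "'a pair_pre_digraph" and A B :: "'a set"
  assumes partition: "clique_partition G A B"
    and saturated: "saturated G A B"
    and nbhd_sym: "v \<in> nbhd G u \<longleftrightarrow> u \<in> nbhd G v"
    and nbhd_subset: "nbhd G u \<subseteq> pverts G"
    and finite_verts: "finite (pverts G)"
begin

lemma swap: "saturated_cobipartite G B A"
  using partition saturated nbhd_sym nbhd_subset finite_verts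
  by unfold_locales (auto simp: clique_partition_def saturated_def)

lemma verts: "pverts G = A \<union> B" "A \<inter> B = {}"
  using partition by (auto simp: clique_partition_def)

lemma adjacent_within:
  "u \<in> A \<Longrightarrow> v \<in> A \<Longrightarrow> u \<noteq> v \<Longrightarrow> v \<in> nbhd G u"
  "u \<in> B \<Longrightarrow> v \<in> B \<Longrightarrow> u \<noteq> v \<Longrightarrow> v \<in> nbhd G u"
  using partition by (auto simp: clique_partition_def clique_def nbhd_def)

lemma staircase_imp_zero_forcing_set:
  assumes s: "staircase (\<lambda>u v. v \<in> nbhd G u) k r c"
    and r: "r ` {..<k} \<subseteq> A" and c: "c ` {..<k} \<subseteq> B"
  shows "zero_forcing_set G (pverts G - c ` {..<k})"
proof -
  \<comment> \<open>State \<open>l\<close> has the first \<open>l\<close> targets filled. The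
    induction descends from \<open>l = k\<close>, where everything is filled: \<open>r l\<close> is
    filled from the start, and among the unfilled \<open>c l\<close>, ..., \<open>c (k - 1)\<close>
    it sees only \<open>c l\<close>.\<close>
  have "(force_step G)\<^sup>*\<^sup>* (pverts G - c ` {l..<k}) (pverts G)" if "l \<le> k" for l
    using that
  proof (induction rule: inc_induct)
    case base
    then show ?case by simp
  next
    case (step l)
    have split: "{l..<k} = insert l {Suc l..<k}" using step by auto
    have notin: "c l \<notin> c ` {Suc l..<k}"
      using staircase_inj_on(2)[OF s] step by (auto dest: inj_onD)
    have rl: "r l \<in> A" and cl: "c l \<in> pverts G"
      using r c step.hyps verts(1) by auto
    have "force_step G (pverts G - c ` {l..<k}) (insert (c l) (pverts G - c ` {l..<k}))"
    proof (rule force_step.force)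
      have "c ` {l..<k} \<subseteq> B" using c by (auto simp: image_subset_iff)
      then show "r l \<in> pverts G - c ` {l..<k}"
        using rl verts by blast
      have "c l \<in> nbhd G (r l)" "\<forall>j\<in>{Suc l..<k}. c j \<notin> nbhd G (r l)"
        using s step.hyps by (auto simp: staircase_def)
      then show "nbhd G (r l) - (pverts G - c ` {l..<k}) = {c l}"
        using nbhd_subset[of "r l"] unfolding split by auto
    qed
    moreover have "insert (c l) (pverts G - c ` {l..<k}) = pverts G - c ` {Suc l..<k}"
      unfolding split using notin cl by auto
    ultimately show ?case
      using step.IH by (metis converse_rtranclp_into_rtranclp)
  qed
  from this[of 0] show ?thesis
    by (auto simp: zero_forcing_set_def atLeast0LessThan)
qed

text \<open>Backward induction along the forces, each one prepending a row and a column. That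
  \<open>c\<close> lists exactly the unfilled part of \<open>B\<close> is what shows that the new
  row misses all later columns.\<close>

lemma staircase_of_forces:
  assumes "(force_step G)\<^sup>*\<^sup>* F (pverts G)" "A \<subseteq> F"
  shows "\<exists>r c. staircase (\<lambda>u v. v \<in> nbhd G u) (card (B - F)) r c \<and>
           r ` {..<card (B - F)} \<subseteq> A \<and> c ` {..<card (B - F)} = B - F"
  using assms
proof (induction rule: converse_rtranclp_induct)
  case base
  have empty: "B - pverts G = {}" using verts by auto
  show ?case unfolding empty by (simp add: staircase_def)
next
  case (step F F')
  from step.hyps(1) obtain u w where uw: "F' = insert w F" "u \<in> F" "nbhd G u - F = {w}"
    by cases auto
  then have "w \<in> nbhd G u" "w \<notin> F" by auto
  then have w: "w \<in> B - F"
    using nbhd_subset[of u] verts(1) step.prems by blast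
  let ?k = "card (B - F')"
  have B_eq: "B - F = insert w (B - F')" using uw w by auto
  have "finite (B - F')" using finite_verts verts by simp
  then have card_eq: "card (B - F) = Suc ?k" unfolding B_eq using uw by simp
  obtain r c where rc: "staircase (\<lambda>u v. v \<in> nbhd G u) ?k r c"
    "r ` {..<?k} \<subseteq> A" "c ` {..<?k} = B - F'"
    using step.IH step.prems uw by blast
  have "\<exists>a\<in>A. w \<in> nbhd G a \<and> (\<forall>v\<in>B - F'. v \<notin> nbhd G a)"
  proof (cases "u \<in> A")
    case True
    then show ?thesis using uw by auto
  next
    case False
    then have "u \<in> B"
      using uw nbhd_sym[of w u] nbhd_subset[of w] verts by auto
    \<comment> \<open>A source in \<open>B\<close> sees all other vertices of \<open>B\<close>, so
      \<open>w\<close> is the last unfilled one. Any neighbor of \<open>w\<close> in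
      \<open>A\<close>, supplied by saturation, can then take the place of \<open>u\<close>.\<close>
    then have "B - F \<subseteq> {w}"
      using adjacent_within(2)[of u] uw by blast
    then have "B - F' = {}" using uw by auto
    moreover obtain a where "a \<in> A" "w \<in> nbhd G a"
      using saturated w nbhd_sym[of w] unfolding saturated_def by blast
    ultimately show ?thesis by auto
  qed
  then obtain a where a: "a \<in> A" "w \<in> nbhd G a" "\<forall>v\<in>B - F'. v \<notin> nbhd G a" by blast
  have "staircase (\<lambda>u v. v \<in> nbhd G u) (Suc ?k) (case_nat a r) (case_nat w c)"
    using rc(1,3) a by (intro staircase_Cons) auto
  moreover have "case_nat a r ` {..<Suc ?k} \<subseteq> A" "case_nat w c ` {..<Suc ?k} = B - F"
    using rc(2) a(1) by (auto simp: lessThan_Suc_eq_insert_0 image_image rc(3) B_eq)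
  ultimately show ?case unfolding card_eq by blast
qed

lemma staircase_of_first_force:
  assumes "(force_step G)\<^sup>*\<^sup>* (insert w F) (pverts G)" "u \<in> F" "nbhd G u - F = {w}" "u \<in> A"
  shows "\<exists>r c. staircase (\<lambda>u v. v \<in> nbhd G u) (card (pverts G - F)) r c \<and>
           r ` {..<card (pverts G - F)} \<subseteq> A \<and> c ` {..<card (pverts G - F)} \<subseteq> B"
proof (cases "A \<subseteq> F")
  case True
  then have eq: "pverts G - F = B - F" using verts by auto
  have "(force_step G)\<^sup>*\<^sup>* F (pverts G)"
    using assms by (meson converse_rtranclp_into_rtranclp force_step.force)
  then show ?thesis
    using staircase_of_forces[OF _ True] unfolding eq by blast
next
  case False
  \<comment> \<open>The source sees all other vertices of \<open>A\<close>, so only \<open>w\<close>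
    can be unfilled there.\<close>
  have sub: "A \<subseteq> insert w F"
    using adjacent_within(1)[of u] assms by blast
  with False have w: "w \<in> A" "w \<notin> F" by auto
  let ?k = "card (B - insert w F)"
  have V_eq: "pverts G - F = insert w (B - insert w F)" using sub verts w by auto
  have "finite (B - insert w F)" using finite_verts verts by simp
  then have card_eq: "card (pverts G - F) = Suc ?k" unfolding V_eq by simp
  obtain r c where rc: "staircase (\<lambda>u v. v \<in> nbhd G u) ?k r c"
    "r ` {..<?k} \<subseteq> A" "c ` {..<?k} = B - insert w F"
    using staircase_of_forces[OF assms(1) sub] by blast
  \<comment> \<open>The vertex \<open>b\<close> stands in for the target \<open>w\<close>, which
    lies in \<open>A\<close>. The later columns are unfilled and differ from \<open>w\<close>, hence
    are not adjacent to \<open>u\<close>.\<close>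
  obtain b where b: "b \<in> B" "b \<in> nbhd G u"
    using saturated assms(4) by (auto simp: saturated_def)
  have "staircase (\<lambda>u v. v \<in> nbhd G u) (Suc ?k) (case_nat u r) (case_nat b c)"
    using rc(1,3) b assms(3) by (intro staircase_Cons) auto
  moreover have "case_nat u r ` {..<Suc ?k} \<subseteq> A" "case_nat b c ` {..<Suc ?k} \<subseteq> B"
    using rc(2) assms(4) b(1) by (auto simp: lessThan_Suc_eq_insert_0 image_image rc(3))
  ultimately show ?thesis unfolding card_eq by blast
qed

lemma zero_forcing_set_imp_staircase:
  assumes "zero_forcing_set G F"
  shows "\<exists>r c. staircase (\<lambda>u v. v \<in> nbhd G u) (card (pverts G - F)) r c \<and>
           r ` {..<card (pverts G - F)} \<subseteq> A \<and> c ` {..<card (pverts G - F)} \<subseteq> B"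
proof -
  have F: "(force_step G)\<^sup>*\<^sup>* F (pverts G)" "F \<subseteq> pverts G"
    using assms by (auto simp: zero_forcing_set_def)
  from F(1) show ?thesis
  proof (cases rule: converse_rtranclpE)
    case base
    then show ?thesis by (simp add: staircase_def)
  next
    case (step F')
    from step(1) obtain u w where uw: "F' = insert w F" "u \<in> F" "nbhd G u - F = {w}"
      by cases auto
    show ?thesis
    proof (cases "u \<in> A")
      case True
      then show ?thesis using staircase_of_first_force step(2) uw by auto
    next
      case False
      let ?k = "card (pverts G - F)"
      from False have "u \<in> B" using uw F(2) verts by auto
      then obtain r c where rc: "staircase (\<lambda>u v. v \<in> nbhd G u) ?k r c"
        "r ` {..<?k} \<subseteq> B" "c ` {..<?k} \<subseteq> A"
        using saturated_cobipartite.staircase_of_first_force[OF swap] step(2) uw by blast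
      \<comment> \<open>The swapped lemma yields sources in \<open>B\<close> and targets in
        \<open>A\<close>; reversal and the symmetry of adjacency restore the required sides.\<close>
      have "staircase (\<lambda>u v. v \<in> nbhd G u) ?k (\<lambda>i. c (?k - Suc i)) (\<lambda>i. r (?k - Suc i))"
        using staircase_rev[OF rc(1)] by (subst nbhd_sym)
      then show ?thesis
        using rc(2,3)
        by (intro exI[of _ "\<lambda>i. c (?k - Suc i)"] exI[of _ "\<lambda>i. r (?k - Suc i)"]) auto
    qed
  qed
qed

end

section \<open>The two bounds for the graph of a pattern\<close>

theorem theorem4p8:
  fixes Y :: zn_pattern and m n :: nat and G :: "(nat + nat) pair_pre_digraph"
  assumes "Y \<in> carrier_mat m n"
    and "G = cobipartite_graph Y"
    and "saturated G (row_verts Y) (col_verts Y)"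
  shows "int (zero_forcing_number G) = int m + int n - int (tri Y)"
proof -
  have Inl_Inr: "Inr j \<in> nbhd G (Inl i) \<longleftrightarrow> i < dim_row Y \<and> j < dim_col Y \<and> Y $$ (i, j) = Star"
    for i j
    by (auto simp: assms(2) nbhd_def cobipartite_graph_def row_verts_def col_verts_def)
  interpret saturated_cobipartite G "row_verts Y" "col_verts Y"
  proof
    show "clique_partition G (row_verts Y) (col_verts Y)"
      using clique_partition_cobipartite_graph assms(2) by simp
  qed (use assms(3) in \<open>auto simp: assms(2) nbhd_def cobipartite_graph_def
      row_verts_def col_verts_def\<close>)
  have card_verts: "card (pverts G) = m + n"
    using assms(1) verts finite_verts
    by (simp add: card_Un_disjoint row_verts_def col_verts_def card_image)
  obtain r c where rc: "staircase (\<lambda>i j. Y $$ (i, j) = Star) (tri Y) r c"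
    "r ` {..<tri Y} \<subseteq> {..<dim_row Y}" "c ` {..<tri Y} \<subseteq> {..<dim_col Y}"
    by (rule ex_staircase_tri)
  let ?c = "\<lambda>i. Inr (c i) :: nat + nat"
  have "staircase (\<lambda>u v. v \<in> nbhd G u) (tri Y) (\<lambda>i. Inl (r i)) ?c"
    using rc by (auto simp: staircase_def Inl_Inr)
  note s = this staircase_inj_on(2)[OF this]
  have sub: "?c ` {..<tri Y} \<subseteq> col_verts Y"
    using rc(3) by (auto simp: col_verts_def)
  have zfs: "zero_forcing_set G (pverts G - ?c ` {..<tri Y})"
    using rc(2) by (intro staircase_imp_zero_forcing_set[OF s(1) _ sub]) (auto simp: row_verts_def)
  have sub_verts: "?c ` {..<tri Y} \<subseteq> pverts G"
    using sub verts(1) by auto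
  \<comment> \<open>Keeps the natural subtraction \<open>m + n - tri Y\<close> from truncating when
    passing to integers.\<close>
  have tri_le: "tri Y \<le> m + n"
    using card_mono[OF finite_verts sub_verts] by (simp add: card_image[OF s(2)] card_verts)
  have card_zfs: "card (pverts G - ?c ` {..<tri Y}) = m + n - tri Y"
    using sub_verts by (simp add: card_Diff_subset card_image[OF s(2)] card_verts)
  have lower: "m + n - tri Y \<le> card F" if F: "zero_forcing_set G F" for F
  proof -
    let ?k = "card (pverts G - F)"
    obtain r c where rc: "staircase (\<lambda>u v. v \<in> nbhd G u) ?k r c"
      "r ` {..<?k} \<subseteq> row_verts Y" "c ` {..<?k} \<subseteq> col_verts Y"
      using zero_forcing_set_imp_staircase[OF F] by blast
    have lt: "\<exists>i<dim_row Y. r l = Inl i" "\<exists>j<dim_col Y. c l = Inr j" if "l < ?k" for l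
      using rc(2,3) that by (auto simp: row_verts_def col_verts_def)
    \<comment> \<open>\<open>projl\<close> and \<open>projr\<close> recover matrix indices;
      \<open>lt\<close> guarantees that they meet the right constructors.\<close>
    have star: "Y $$ (projl (r i), projr (c j)) = Star \<longleftrightarrow> c j \<in> nbhd G (r i)"
      if "i < ?k" "j < ?k" for i j
      using lt(1)[OF that(1)] lt(2)[OF that(2)] by (auto simp: Inl_Inr)
    have "staircase (\<lambda>i j. Y $$ (i, j) = Star) ?k (\<lambda>i. projl (r i)) (\<lambda>i. projr (c i))"
      using rc(1) by (simp add: staircase_def star)
    then have "?k \<le> tri Y"
      by (rule staircase_le_tri) (use lt in fastforce)+
    moreover have "?k = m + n - card F"
      using F finite_verts by (subst card_Diff_subset)
        (auto simp: zero_forcing_set_def card_verts intro: finite_subset)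
    ultimately show ?thesis by simp
  qed
  have "zero_forcing_number G = m + n - tri Y"
    unfolding zero_forcing_number_def using zfs card_zfs lower by (intro Least_equality) auto
  then show ?thesis using tri_le by simp
qed

end
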